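(* Let $n\ge 2$, $d=2r\ge 2$, $0\le\beta<\infty$, positions $p_1,\dots,p_n\in\mathbb{R}$ and frequencies $\omega_1,\dots,\omega_r\in\mathbb{R}$ be given. For every initial state in $(\mathbb{S}^{d-1})^n$, the RoPE spherical self-attention flow $$\dot x_i=\sum_{j=1}^n A_{ij}(x)\bigl(x_j-\langle x_i,x_j\rangle x_i\bigr),\qquad i=1,\dots,n,$$ has a unique global solution (defined for all $t\ge 0$) in $(\mathbb{S}^{d-1})^n$. At every state $x\in(\mathbb{S}^{d-1})^n$, one has $W(x)=W(x)^\top$, $A(x)\mathbf 1=\mathbf 1$ (where $\mathbf 1$ is the all-ones vector), and $$\pi_iA_{ij}=\pi_jA_{ji}\quad\text{for all } i,j,\qquad \pi_i=\frac{Z_i}{\sum_k Z_k}.$$ Moreover, for all $x\in(\mathbb{S}^{d-1})^n$ and all $i,j$, $$A_{ij}(x)\ \ge\ \underline a_{\beta,n}:=\frac{1}{1+(n-1)e^{2\beta}}=\frac{e^{-2\beta}}{n-1+e^{-2\beta}}.$$ The constant is sharp over the model class: for given $n$ and $\beta$, no constant larger than $\underline a_{\beta,n}$ is a lower bound for $A_{ij}(x)$ valid for all systems (positions and frequencies), all states $x$, and all $i,j$. At $\beta=0$ it equals $1/n$, and for $\beta>0$ it satisfies $\underline a_{\beta,n}>e^{-2\beta}/n$.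
   Context: Let $n\ge2$ and $d=2r$ with $r\ge1$. Token $i\in\{1,\dots,n\}$ has a fixed position $p_i\in\mathbb{R}$ and state $x_i\in\mathbb{S}^{d-1}$ (unit sphere of $\mathbb{R}^d$); $x=(x_1,\dots,x_n)$. For real frequencies $\omega_1,\dots,\omega_r$, define the block rotation $R_p=\bigoplus_{\ell=1}^r\begin{pmatrix}\cos(\omega_\ell p)&-\sin(\omega_\ell p)\\ \sin(\omega_\ell p)&\cos(\omega_\ell p)\end{pmatrix}$. For finite $\beta\ge0$ define the scores $s_{ij}(x)=\langle R_{p_i}x_i,R_{p_j}x_j\rangle$, the kernel $W_{ij}(x)=e^{\beta s_{ij}(x)}$, the degrees $Z_i(x)=\sum_{k=1}^nW_{ik}(x)$, and the attention weights $A_{ij}(x)=W_{ij}(x)/Z_i(x)$. *)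

theory Defs
  imports "HOL-Analysis.Analysis"
begin

text \<open>
  The ambient space \<open>\<real>\<^sup>d\<close> with \<open>d = 2r\<close> is \<^typ>\<open>real ^ ('r \<times> 2)\<close>, where \<open>r = CARD('r)\<close>: the
  coordinate \<open>(l, a)\<close> is the \<open>a\<close>-th coordinate of the \<open>l\<close>-th plane. A state
  \<open>x = (x\<^sub>1, \<dots>, x\<^sub>n)\<close> is a vector of vectors, where \<open>n = CARD('n)\<close>.
\<close>

type_synonym ('r, 'n) state = "(real ^ ('r \<times> 2)) ^ 'n"

definition states :: "('r::finite, 'n::finite) state set" where
  "states = {x. \<forall>i. x $ i \<in> sphere 0 1}"

definition rotation2 :: "real \<Rightarrow> real ^ 2 ^ 2" where
  "rotation2 \<theta> = vector [vector [cos \<theta>, - sin \<theta>], vector [sin \<theta>, cos \<theta>]]"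

definition block_rotation ::
    "('r::finite \<Rightarrow> real) \<Rightarrow> real \<Rightarrow> real ^ ('r \<times> 2) ^ ('r \<times> 2)" where
  "block_rotation \<omega> p =
     (\<chi> u v. if fst u = fst v then rotation2 (\<omega> (fst u) * p) $ snd u $ snd v else 0)"

definition score ::
    "('n::finite \<Rightarrow> real) \<Rightarrow> ('r::finite \<Rightarrow> real) \<Rightarrow> ('r, 'n) state \<Rightarrow> 'n \<Rightarrow> 'n \<Rightarrow> real" where
  "score p \<omega> x i j =
     inner (block_rotation \<omega> (p i) *v (x $ i)) (block_rotation \<omega> (p j) *v (x $ j))"

definition kernel ::
    "real \<Rightarrow> ('n::finite \<Rightarrow> real) \<Rightarrow> ('r::finite \<Rightarrow> real) \<Rightarrow> ('r, 'n) state \<Rightarrow> real ^ 'n ^ 'n" where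
  "kernel \<beta> p \<omega> x = (\<chi> i j. exp (\<beta> * score p \<omega> x i j))"

definition degree ::
    "real \<Rightarrow> ('n::finite \<Rightarrow> real) \<Rightarrow> ('r::finite \<Rightarrow> real) \<Rightarrow> ('r, 'n) state \<Rightarrow> 'n \<Rightarrow> real" where
  "degree \<beta> p \<omega> x i = (\<Sum>k\<in>UNIV. kernel \<beta> p \<omega> x $ i $ k)"

definition attention ::
    "real \<Rightarrow> ('n::finite \<Rightarrow> real) \<Rightarrow> ('r::finite \<Rightarrow> real) \<Rightarrow> ('r, 'n) state \<Rightarrow> real ^ 'n ^ 'n" where
  "attention \<beta> p \<omega> x = (\<chi> i j. kernel \<beta> p \<omega> x $ i $ j / degree \<beta> p \<omega> x i)"

definition stationary ::
    "real \<Rightarrow> ('n::finite \<Rightarrow> real) \<Rightarrow> ('r::finite \<Rightarrow> real) \<Rightarrow> ('r, 'n) state \<Rightarrow> 'n \<Rightarrow> real" where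
  "stationary \<beta> p \<omega> x i = degree \<beta> p \<omega> x i / (\<Sum>k\<in>UNIV. degree \<beta> p \<omega> x k)"

definition velocity ::
    "real \<Rightarrow> ('n::finite \<Rightarrow> real) \<Rightarrow> ('r::finite \<Rightarrow> real) \<Rightarrow> ('r, 'n) state \<Rightarrow> 'n \<Rightarrow> real ^ ('r \<times> 2)" where
  "velocity \<beta> p \<omega> x i =
     (\<Sum>j\<in>UNIV. attention \<beta> p \<omega> x $ i $ j *\<^sub>R (x $ j - inner (x $ i) (x $ j) *\<^sub>R (x $ i)))"

text \<open>The values of \<open>X\<close> at negative times are irrelevant; the derivative at time \<open>0\<close> is one-sided.\<close>

definition global_solution ::
    "real \<Rightarrow> ('n::finite \<Rightarrow> real) \<Rightarrow> ('r::finite \<Rightarrow> real) \<Rightarrow> ('r, 'n) state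
      \<Rightarrow> (real \<Rightarrow> ('r, 'n) state) \<Rightarrow> bool" where
  "global_solution \<beta> p \<omega> x0 X \<longleftrightarrow>
     X 0 = x0 \<and>
     (\<forall>t\<ge>0. X t \<in> states \<and>
        (\<forall>i. ((\<lambda>s. X s $ i) has_vector_derivative velocity \<beta> p \<omega> (X t) i) (at t within {0..})))"

definition attention_floor :: "real \<Rightarrow> nat \<Rightarrow> real" where
  "attention_floor \<beta> n = 1 / (1 + (real n - 1) * exp (2 * \<beta>))"

end

theory Submission
  imports Defs
begin

text \<open>
  The velocity grows too fast away from the states to be globally Lipschitz, and its solutions are
  wanted on the product of spheres only. Two modifications turn it into a globally Lipschitz field on
  the whole vector space without changing it on the states. First, each token is replaced by its
  nearest point in the closed unit ball, so that all functions involved become bounded, and bounded Lipschitz functions are closed under the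
  operations from which the attention weights are built (\<open>bounded_lipschitz_tangent_field\<close>).
  Second, \<open>x\<^sub>j - \<langle>x\<^sub>i, x\<^sub>j\<rangle> x\<^sub>i\<close> is written homogeneously as
  \<open>\<langle>x\<^sub>i, x\<^sub>i\<rangle> x\<^sub>j - \<langle>x\<^sub>i, x\<^sub>j\<rangle> x\<^sub>i\<close>, which is orthogonal to \<open>x\<^sub>i\<close> even off the sphere. Hence every
  solution of the extended equation keeps the norm of each token
  (\<open>tangent_field_solution_in_states\<close>), and solutions that start in the states are exactly the
  solutions of the original flow. Existence is then the Picard-Lindeloef theorem for a globally
  Lipschitz field (\<open>lipschitz_global_solution_exists\<close>), and uniqueness is a Gronwall estimate for the
  squared distance of two solutions (\<open>lipschitz_solution_unique\<close>).

  The algebraic claims come from the symmetry of the scores: \<open>\<pi>\<^sub>i A\<^sub>i\<^sub>j\<close> is the symmetric kernel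
  \<open>W\<^sub>i\<^sub>j\<close> divided by the total degree. The block rotations are isometries, so scores of states lie in
  \<open>[-1, 1]\<close>. The weight \<open>W\<^sub>i\<^sub>j / (W\<^sub>i\<^sub>j + rest)\<close> increases in \<open>W\<^sub>i\<^sub>j \<ge> exp (-\<beta>)\<close> and decreases in
  the other \<open>n - 1\<close> entries of its row, which are at most \<open>exp \<beta>\<close>; this gives the floor
  (\<open>attention_ge_floor\<close>). All these bounds are equalities for trivial rotations when one token is
  antipodal to all the others, which coincide (\<open>attention_floor_attained\<close>).
\<close>

section \<open>Ordinary differential equations with a globally Lipschitz field\<close>

lemma integral_has_vector_derivative_halfline:
  fixes g :: "real \<Rightarrow> 'a::banach"
  assumes "continuous_on UNIV g" and "0 \<le> t"
  shows "((\<lambda>u. integral {0..u} g) has_vector_derivative g t) (at t within {0..})"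
proof -
  have "((\<lambda>u. integral {0..u} g) has_vector_derivative g t) (at t within {0..t + 1})"
    by (rule integral_has_vector_derivative) (use assms in \<open>auto intro: continuous_on_subset\<close>)
  moreover have "at t within {0..t + 1} = at t within {0..}"
    by (rule at_within_nhd[of t "{..<t + 1}"]) auto
  ultimately show ?thesis by simp
qed

text \<open>
  Integration gains a factor \<open>1 / a\<close> in the norm \<open>sup\<^sub>t exp (- a t) |u t|\<close>. For large \<open>a\<close> this makes the
  Picard operator a contraction on the whole half-line at once, without gluing local solutions.
\<close>

lemma weighted_integral_bound:
  fixes u :: "real \<Rightarrow> 'a::banach"
  assumes "0 < a" and "0 \<le> t" and cont: "continuous_on {0..t} u"
    and bound: "\<And>s. s \<in> {0..t} \<Longrightarrow> norm (u s) \<le> B * exp (a * s)"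
  shows "norm (exp (- a * t) *\<^sub>R integral {0..t} u) \<le> B / a"
proof -
  have "norm (u 0) \<le> B * exp (a * 0)"
    using bound \<open>0 \<le> t\<close> by (intro bound) simp
  then have "0 \<le> B"
    by (simp add: order_trans[OF norm_ge_zero])
  have int: "((\<lambda>s. B * exp (a * s)) has_integral (B / a * exp (a * t) - B / a * exp (a * 0))) {0..t}"
    using \<open>0 < a\<close> \<open>0 \<le> t\<close>
    by (intro fundamental_theorem_of_calculus)
       (auto intro!: derivative_eq_intros simp flip: has_real_derivative_iff_has_vector_derivative)
  have "norm (integral {0..t} u) \<le> integral {0..t} (\<lambda>s. B * exp (a * s))"
    using int bound cont
    by (intro integral_norm_bound_integral) (auto intro: integrable_continuous_real)
  also have "\<dots> \<le> B / a * exp (a * t)"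
    unfolding integral_unique[OF int] using \<open>0 \<le> B\<close> \<open>0 < a\<close> by simp
  finally have "exp (- a * t) * norm (integral {0..t} u) \<le> exp (- a * t) * (B / a * exp (a * t))"
    by (intro mult_left_mono) auto
  also have "\<dots> = B / a"
    by (simp add: exp_minus field_simps)
  finally show ?thesis by simp
qed

text \<open>
  The substitution \<open>X t = exp (a t) Z t\<close> turns the integral equation for \<open>X\<close> into a fixed point equation
  for a bounded continuous function \<open>Z\<close>, to which the Banach fixed point theorem applies.
\<close>

theorem lipschitz_global_solution_exists:
  fixes F :: "'a::banach \<Rightarrow> 'a"
  assumes "L-lipschitz_on UNIV F"
  shows "\<exists>X. X 0 = x0 \<and> (\<forall>t\<ge>0. (X has_vector_derivative F (X t)) (at t within {0..}))"
proof -
  \<comment> \<open>A positive Lipschitz constant is needed to divide by it below.\<close>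
  define K where "K = L + 1"
  have "0 < K" and lip: "K-lipschitz_on UNIV F"
    using lipschitz_on_nonneg[OF assms] assms by (auto simp: K_def intro: lipschitz_on_le)
  have contF: "continuous_on UNIV F"
    by (rule lipschitz_on_continuous_on[OF lip])
  \<comment> \<open>With this weight the contraction factor is \<open>K / a = 1 / 2\<close>.\<close>
  define a where "a = 2 * K"
  have "0 < a" using \<open>0 < K\<close> by (simp add: a_def)
  define g where "g Z s = F (exp (a * s) *\<^sub>R apply_bcontfun Z s)" for Z s
  have cont_g: "continuous_on S (g Z)" for S Z
    unfolding g_def
    by (intro continuous_on_compose2[OF contF] continuous_intros) auto
  have deriv_g: "((\<lambda>u. integral {0..u} (g Z)) has_vector_derivative g Z t) (at t within {0..})"
    if "0 \<le> t" for Z t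
    using that by (intro integral_has_vector_derivative_halfline cont_g)
  \<comment> \<open>Bounded continuous functions live on all of \<open>\<real>\<close>, so the Picard operator is extended to negative
  times by its value at \<open>0\<close>.\<close>
  define P where "P Z t = exp (- a * max 0 t) *\<^sub>R (x0 + integral {0..max 0 t} (g Z))" for Z t
  have P_bcontfun: "P Z \<in> bcontfun" for Z
  proof (rule bcontfun_normI)
    have "continuous_on {0..} (\<lambda>t. integral {0..t} (g Z))"
      by (auto simp: continuous_on_eq_continuous_within
          intro!: has_vector_derivative_continuous deriv_g)
    then have "continuous_on UNIV (\<lambda>t. integral {0..max 0 t} (g Z))"
      by (rule continuous_on_compose2) (auto intro!: continuous_intros)
    then show "continuous_on UNIV (P Z)"
      unfolding P_def by (intro continuous_intros)
    fix t
    have bound: "norm (g Z s) \<le> (norm (F 0) + K * norm Z) * exp (a * s)" if "0 \<le> s" for s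
    proof -
      have "norm (g Z s) \<le> norm (F 0) + norm (g Z s - F 0)"
        by (simp add: norm_triangle_sub)
      also have "norm (g Z s - F 0) \<le> K * norm (exp (a * s) *\<^sub>R apply_bcontfun Z s)"
        using lipschitz_onD[OF lip, of "exp (a * s) *\<^sub>R apply_bcontfun Z s" 0]
        by (simp add: g_def dist_norm)
      also have "\<dots> \<le> K * (exp (a * s) * norm Z)"
        using norm_bounded[of Z s] \<open>0 < K\<close> by (auto intro!: mult_left_mono)
      also have "norm (F 0) \<le> norm (F 0) * exp (a * s)"
        using that \<open>0 < a\<close> by (simp add: mult_le_cancel_left1)
      finally show ?thesis by (simp add: algebra_simps)
    qed
    have "norm (P Z t) \<le> norm (exp (- a * max 0 t) *\<^sub>R x0)
        + norm (exp (- a * max 0 t) *\<^sub>R integral {0..max 0 t} (g Z))"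
      unfolding P_def scaleR_add_right by (rule norm_triangle_ineq)
    also have "norm (exp (- a * max 0 t) *\<^sub>R x0) \<le> norm x0"
      using \<open>0 < a\<close> by (simp add: mult_left_le_one_le)
    also have "norm (exp (- a * max 0 t) *\<^sub>R integral {0..max 0 t} (g Z))
        \<le> (norm (F 0) + K * norm Z) / a"
      using \<open>0 < a\<close> bound cont_g by (intro weighted_integral_bound) auto
    finally show "norm (P Z t) \<le> norm x0 + (norm (F 0) + K * norm Z) / a" by simp
  qed
  have P_diff: "dist (P Y t) (P Z t) \<le> 1 / 2 * dist Y Z" for Y Z t
  proof -
    have "P Y t - P Z t = exp (- a * max 0 t) *\<^sub>R integral {0..max 0 t} (\<lambda>s. g Y s - g Z s)"
      unfolding P_def
      by (subst integral_diff) (auto intro!: integrable_continuous_real cont_g simp: algebra_simps)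
    moreover have "norm (g Y s - g Z s) \<le> K * dist Y Z * exp (a * s)" for s
    proof -
      have "norm (g Y s - g Z s)
          \<le> K * dist (exp (a * s) *\<^sub>R apply_bcontfun Y s) (exp (a * s) *\<^sub>R apply_bcontfun Z s)"
        using lipschitz_onD[OF lip] by (simp add: g_def flip: dist_norm)
      also have "\<dots> = K * exp (a * s) * dist (apply_bcontfun Y s) (apply_bcontfun Z s)"
        by (simp add: dist_norm flip: scaleR_diff_right)
      also have "\<dots> \<le> K * exp (a * s) * dist Y Z"
        using \<open>0 < K\<close> by (intro mult_left_mono dist_bounded) simp
      finally show ?thesis by (simp add: mult_ac)
    qed
    moreover have "continuous_on {0..max 0 t} (\<lambda>s. g Y s - g Z s)"
      by (intro continuous_intros cont_g)
    ultimately have "norm (P Y t - P Z t) \<le> K * dist Y Z / a"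
      using weighted_integral_bound[OF \<open>0 < a\<close>, of "max 0 t" "\<lambda>s. g Y s - g Z s" "K * dist Y Z"]
      by simp
    then show ?thesis using \<open>0 < K\<close> by (simp add: dist_norm a_def)
  qed
  have "\<exists>!Z. Bcontfun (P Z) = Z"
  proof (rule banach_fix_type[of "1 / 2"])
    show "\<forall>Y Z. dist (Bcontfun (P Y)) (Bcontfun (P Z)) \<le> 1 / 2 * dist Y Z"
      by (auto intro!: dist_bound simp only: Bcontfun_inverse[OF P_bcontfun] P_diff)
  qed auto
  then obtain Z where "Bcontfun (P Z) = Z" by blast
  then have fix_Z: "apply_bcontfun Z t = P Z t" for t
    using Bcontfun_inverse[OF P_bcontfun, of Z] by simp
  define X where "X t = exp (a * t) *\<^sub>R apply_bcontfun Z t" for t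
  have X_eq: "X t = x0 + integral {0..t} (g Z)" if "0 \<le> t" for t
    using that by (simp add: X_def fix_Z P_def flip: exp_add)
  have "(X has_vector_derivative F (X t)) (at t within {0..})" if "0 \<le> t" for t
  proof (rule has_vector_derivative_transform)
    show "((\<lambda>t. x0 + integral {0..t} (g Z)) has_vector_derivative F (X t)) (at t within {0..})"
      using deriv_g[OF that, of Z] by (auto simp: g_def X_def intro!: derivative_eq_intros)
  qed (use that X_eq in auto)
  then show ?thesis using X_eq[of 0] by auto
qed

text \<open>
  With \<open>D = X - Y\<close>, the Lipschitz condition gives \<open>(|D|\<^sup>2)' \<le> 2 L |D|\<^sup>2\<close>, so \<open>exp (- 2 L t) |D t|\<^sup>2\<close> is
  nonincreasing; it starts at \<open>0\<close>.
\<close>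

theorem lipschitz_solution_unique:
  fixes F :: "'a::real_inner \<Rightarrow> 'a"
  assumes lip: "L-lipschitz_on S F"
    and X: "\<And>t. 0 \<le> t \<Longrightarrow> X t \<in> S"
      "\<And>t. 0 \<le> t \<Longrightarrow> (X has_vector_derivative F (X t)) (at t within {0..})"
    and Y: "\<And>t. 0 \<le> t \<Longrightarrow> Y t \<in> S"
      "\<And>t. 0 \<le> t \<Longrightarrow> (Y has_vector_derivative F (Y t)) (at t within {0..})"
    and init: "X 0 = Y 0" and "0 \<le> t"
  shows "X t = Y t"
proof -
  define D where "D s = X s - Y s" for s
  define E where "E s = F (X s) - F (Y s)" for s
  have deriv_D: "(D has_vector_derivative E s) (at s within {0..})" if "0 \<le> s" for s
    unfolding D_def E_def using that by (intro derivative_intros X Y)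
  define h where "h s = exp (- 2 * L * s) * (D s \<bullet> D s)" for s
  have "h t \<le> h 0"
  proof (rule DERIV_nonpos_imp_decreasing_open[OF \<open>0 \<le> t\<close>])
    have "continuous_on {0..} D"
      by (auto simp: continuous_on_eq_continuous_within
          intro!: has_vector_derivative_continuous deriv_D)
    then have "continuous_on {0..t} D"
      by (rule continuous_on_subset) auto
    then show "continuous_on {0..t} h"
      unfolding h_def by (intro continuous_intros)
    fix s assume "0 < s" "s < t"
    then have "at s within {0..} = at s" by (intro at_within_interior) auto
    with \<open>0 < s\<close> deriv_D[of s] have "(D has_derivative (\<lambda>x. x *\<^sub>R E s)) (at s)"
      by (simp add: has_vector_derivative_def)
    then have "(h has_derivative (\<lambda>x. x * (exp (- 2 * L * s) * (2 * (D s \<bullet> E s) - 2 * L * (D s \<bullet> D s))))) (at s)"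
      unfolding h_def
      by (auto intro!: derivative_eq_intros simp: algebra_simps inner_commute)
    then have "DERIV h s :> exp (- 2 * L * s) * (2 * (D s \<bullet> E s) - 2 * L * (D s \<bullet> D s))"
      by (rule has_derivative_imp_has_field_derivative) simp
    moreover have "D s \<bullet> E s \<le> L * (D s \<bullet> D s)"
    proof -
      have "norm (E s) \<le> L * norm (D s)"
        unfolding E_def D_def using \<open>0 < s\<close> by (intro lipschitz_on_normD[OF lip] X Y) auto
      then have "norm (D s) * norm (E s) \<le> norm (D s) * (L * norm (D s))"
        by (intro mult_left_mono) auto
      with norm_cauchy_schwarz[of "D s" "E s"] show ?thesis
        by (simp add: dot_square_norm power2_eq_square mult_ac)
    qed
    ultimately show "\<exists>y. DERIV h s :> y \<and> y \<le> 0"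
      by (auto simp: mult_le_0_iff)
  qed
  moreover have "h 0 = 0" by (simp add: h_def D_def init)
  ultimately have "D t \<bullet> D t \<le> 0" by (simp add: h_def mult_le_0_iff)
  then have "D t = 0" by (metis inner_eq_zero_iff inner_ge_zero order_antisym)
  then show ?thesis by (simp add: D_def)
qed

section \<open>Bounded Lipschitz functions\<close>

text \<open>
  Lipschitz functions alone are not closed under products, and \<open>exp\<close> is not Lipschitz; together with
  boundedness the class is closed under everything needed for the softmax.
\<close>

definition bounded_lipschitz :: "('a::metric_space \<Rightarrow> 'b::real_normed_vector) \<Rightarrow> bool" where
  "bounded_lipschitz f \<longleftrightarrow> (\<exists>B. \<forall>x. norm (f x) \<le> B) \<and> (\<exists>L. L-lipschitz_on UNIV f)"

lemma bounded_lipschitzI: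
  assumes "\<And>x. norm (f x) \<le> B" and "\<And>x y. norm (f x - f y) \<le> L * dist x y"
  shows "bounded_lipschitz f"
proof -
  have "\<bar>L\<bar>-lipschitz_on UNIV f"
  proof (rule lipschitz_onI)
    show "dist (f x) (f y) \<le> \<bar>L\<bar> * dist x y" for x y
      using order_trans[OF assms(2)[of x y] mult_right_mono[OF abs_ge_self zero_le_dist]]
      by (simp add: dist_norm)
  qed simp
  with assms(1) show ?thesis by (auto simp: bounded_lipschitz_def)
qed

lemma bounded_lipschitzE:
  assumes "bounded_lipschitz f"
  obtains B L where "0 \<le> B" "0 \<le> L" "\<And>x. norm (f x) \<le> B"
    "\<And>x y. norm (f x - f y) \<le> L * dist x y"
proof -
  obtain B L where B: "\<And>x. norm (f x) \<le> B" and L: "L-lipschitz_on UNIV f"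
    using assms by (auto simp: bounded_lipschitz_def)
  show thesis
    using that[of B L] B lipschitz_onD[OF L] lipschitz_on_nonneg[OF L] order_trans[OF norm_ge_zero B]
    by (simp add: dist_norm)
qed

lemma bounded_lipschitz_const: "bounded_lipschitz (\<lambda>_. c)"
  by (rule bounded_lipschitzI[of _ "norm c" 0]) auto

lemma bounded_lipschitz_add:
  assumes "bounded_lipschitz f" "bounded_lipschitz g"
  shows "bounded_lipschitz (\<lambda>x. f x + g x)"
proof -
  obtain B L where f: "0 \<le> B" "0 \<le> L" "\<And>x. norm (f x) \<le> B" "\<And>x y. norm (f x - f y) \<le> L * dist x y"
    using assms(1) by (rule bounded_lipschitzE) (rule that)
  obtain C M where g: "0 \<le> C" "0 \<le> M" "\<And>x. norm (g x) \<le> C" "\<And>x y. norm (g x - g y) \<le> M * dist x y"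
    using assms(2) by (rule bounded_lipschitzE) (rule that)
  show ?thesis
  proof (rule bounded_lipschitzI)
    show "norm (f x + g x) \<le> B + C" for x
      using f(3) g(3) by (rule norm_add_rule_thm)
    show "norm (f x + g x - (f y + g y)) \<le> (L + M) * dist x y" for x y
      unfolding add_diff_add distrib_right using f(4) g(4) by (rule norm_add_rule_thm)
  qed
qed

lemma bounded_lipschitz_sum:
  assumes "\<And>i. i \<in> I \<Longrightarrow> bounded_lipschitz (f i)"
  shows "bounded_lipschitz (\<lambda>x. \<Sum>i\<in>I. f i x)"
  using assms
  by (induction I rule: infinite_finite_induct)
     (auto intro!: bounded_lipschitz_const bounded_lipschitz_add)

lemma bounded_lipschitz_bounded_linear:
  assumes "bounded_linear T" "bounded_lipschitz f"
  shows "bounded_lipschitz (\<lambda>x. T (f x))"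
proof -
  obtain B L where f: "0 \<le> B" "0 \<le> L" "\<And>x. norm (f x) \<le> B" "\<And>x y. norm (f x - f y) \<le> L * dist x y"
    using assms(2) by (rule bounded_lipschitzE) (rule that)
  obtain K where "0 \<le> K" and K: "\<And>v. norm (T v) \<le> norm v * K"
    using bounded_linear.nonneg_bounded[OF assms(1)] by auto
  show ?thesis
  proof (rule bounded_lipschitzI)
    show "norm (T (f x)) \<le> B * K" for x
      using order_trans[OF K mult_right_mono[OF f(3) \<open>0 \<le> K\<close>]] .
    show "norm (T (f x) - T (f y)) \<le> L * K * dist x y" for x y
      using order_trans[OF K mult_right_mono[OF f(4) \<open>0 \<le> K\<close>], of x y]
      by (simp add: linear_diff[OF bounded_linear.linear[OF assms(1)]] mult_ac)
  qed
qed

lemma bounded_lipschitz_bounded_bilinear: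
  assumes T: "bounded_bilinear T" and "bounded_lipschitz f" "bounded_lipschitz g"
  shows "bounded_lipschitz (\<lambda>x. T (f x) (g x))"
proof -
  obtain B L where f: "0 \<le> B" "0 \<le> L" "\<And>x. norm (f x) \<le> B" "\<And>x y. norm (f x - f y) \<le> L * dist x y"
    using assms(2) by (rule bounded_lipschitzE) (rule that)
  obtain C M where g: "0 \<le> C" "0 \<le> M" "\<And>x. norm (g x) \<le> C" "\<And>x y. norm (g x - g y) \<le> M * dist x y"
    using assms(3) by (rule bounded_lipschitzE) (rule that)
  obtain K where K: "0 \<le> K" "\<And>a b. norm (T a b) \<le> norm a * norm b * K"
    using bounded_bilinear.nonneg_bounded[OF T] by auto
  have bound: "norm (T a b) \<le> s * t * K" if "norm a \<le> s" "norm b \<le> t" "0 \<le> s" for a b s t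
    using that K(1) by (intro order_trans[OF K(2)] mult_right_mono mult_mono) auto
  show ?thesis
  proof (rule bounded_lipschitzI)
    show "norm (T (f x) (g x)) \<le> B * C * K" for x
      using f g by (intro bound)
    show "norm (T (f x) (g x) - T (f y) (g y)) \<le> (B * M * K + L * C * K) * dist x y" for x y
    proof -
      have "T (f x) (g x) - T (f y) (g y) = T (f x) (g x - g y) + T (f x - f y) (g y)"
        by (simp add: bounded_bilinear.diff_left[OF T] bounded_bilinear.diff_right[OF T])
      also have "norm \<dots> \<le> B * (M * dist x y) * K + L * dist x y * C * K"
        using f g by (intro norm_add_rule_thm bound) auto
      finally show ?thesis by (simp add: algebra_simps)
    qed
  qed
qed

lemma bounded_lipschitz_diff:
  assumes "bounded_lipschitz f" "bounded_lipschitz g"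
  shows "bounded_lipschitz (\<lambda>x. f x - g x)"
  using bounded_lipschitz_add[OF assms(1)
      bounded_lipschitz_bounded_linear[OF bounded_linear_minus[OF bounded_linear_ident] assms(2)]]
  by simp

lemma bounded_lipschitz_vec:
  fixes f :: "'i::finite \<Rightarrow> 'a::metric_space \<Rightarrow> 'b::real_normed_vector"
  assumes "\<And>i. bounded_lipschitz (f i)"
  shows "bounded_lipschitz (\<lambda>x. \<chi> i. f i x)"
proof -
  have "\<exists>B L. (\<forall>x. norm (f i x) \<le> B) \<and> (\<forall>x y. norm (f i x - f i y) \<le> L * dist x y)" for i
    using assms[of i] by (rule bounded_lipschitzE) blast
  then obtain B L where f: "\<And>i x. norm (f i x) \<le> B i"
      "\<And>i x y. norm (f i x - f i y) \<le> L i * dist x y"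
    by metis
  have norm_vec: "norm v \<le> (\<Sum>i\<in>UNIV. norm (v $ i))" for v :: "'b ^ 'i"
    by (simp add: norm_vec_def L2_set_le_sum)
  show ?thesis
  proof (rule bounded_lipschitzI)
    show "norm (\<chi> i. f i x) \<le> (\<Sum>i\<in>UNIV. B i)" for x
      using f(1) by (intro order_trans[OF norm_vec] sum_mono) simp
    show "norm ((\<chi> i. f i x) - (\<chi> i. f i y)) \<le> (\<Sum>i\<in>UNIV. L i) * dist x y" for x y
      unfolding sum_distrib_right using f(2) by (intro order_trans[OF norm_vec] sum_mono) simp
  qed
qed

text \<open>
  If both values lie in \<open>[-B, B]\<close>, convexity in the form \<open>exp (t - s) \<ge> 1 + (t - s)\<close> bounds the difference
  quotient by \<open>exp B\<close>.
\<close>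

lemma bounded_lipschitz_exp:
  fixes f :: "'a::metric_space \<Rightarrow> real"
  assumes "bounded_lipschitz f"
  shows "bounded_lipschitz (\<lambda>x. exp (f x))"
proof -
  obtain B L where f: "0 \<le> B" "0 \<le> L" "\<And>x. norm (f x) \<le> B" "\<And>x y. norm (f x - f y) \<le> L * dist x y"
    using assms by (rule bounded_lipschitzE) (rule that)
  have exp_diff: "exp s - exp t \<le> exp B * \<bar>s - t\<bar>" if "\<bar>s\<bar> \<le> B" for s t :: real
  proof -
    have "exp s * (1 + (t - s)) \<le> exp s * exp (t - s)"
      by (intro mult_left_mono exp_ge_add_one_self) simp
    also have "\<dots> = exp t" by (simp flip: exp_add)
    finally have "exp s - exp t \<le> exp s * (s - t)" by (simp add: algebra_simps)
    also have "\<dots> \<le> exp s * \<bar>s - t\<bar>"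
      by (intro mult_left_mono) auto
    also have "\<dots> \<le> exp B * \<bar>s - t\<bar>"
      using that by (intro mult_right_mono) auto
    finally show ?thesis .
  qed
  show ?thesis
  proof (rule bounded_lipschitzI)
    show "norm (exp (f x)) \<le> exp B" for x
      using f(3)[of x] by simp
    show "norm (exp (f x) - exp (f y)) \<le> exp B * L * dist x y" for x y
    proof -
      have "norm (exp (f x) - exp (f y)) \<le> exp B * norm (f x - f y)"
        using exp_diff[of "f x" "f y"] exp_diff[of "f y" "f x"] f(3)[of x] f(3)[of y]
        by (simp add: abs_minus_commute abs_le_iff)
      also have "\<dots> \<le> exp B * (L * dist x y)"
        by (intro mult_left_mono f(4)) simp
      finally show ?thesis by (simp add: mult_ac)
    qed
  qed
qed

text \<open>
  The denominator stays above \<open>c > 0\<close>, where \<open>inverse\<close> has slope at most \<open>1 / c\<^sup>2\<close>.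
\<close>

lemma bounded_lipschitz_divide:
  fixes f g :: "'a::metric_space \<Rightarrow> real"
  assumes "bounded_lipschitz f" "bounded_lipschitz g" and "0 < c" and c: "\<And>x. c \<le> g x"
  shows "bounded_lipschitz (\<lambda>x. f x / g x)"
proof -
  obtain B L where g: "0 \<le> B" "0 \<le> L" "\<And>x. norm (g x) \<le> B" "\<And>x y. norm (g x - g y) \<le> L * dist x y"
    using assms(2) by (rule bounded_lipschitzE) (rule that)
  have pos: "0 < g x" for x using \<open>0 < c\<close> c[of x] by linarith
  have "bounded_lipschitz (\<lambda>x. inverse (g x))"
  proof (rule bounded_lipschitzI)
    show inv: "norm (inverse (g x)) \<le> inverse c" for x
      using \<open>0 < c\<close> c[of x] pos[of x] by (simp add: le_imp_inverse_le)
    show "norm (inverse (g x) - inverse (g y)) \<le> inverse c * inverse c * L * dist x y" for x y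
    proof -
      have "inverse (g x) - inverse (g y) = inverse (g x) * inverse (g y) * (g y - g x)"
        using pos[of x] pos[of y] by (simp add: field_simps)
      also have "norm \<dots> \<le> inverse c * inverse c * (L * dist x y)"
        unfolding norm_mult using \<open>0 < c\<close> g(4)[of y x]
        by (intro mult_mono inv) (auto simp: dist_commute)
      finally show ?thesis by (simp add: mult_ac)
    qed
  qed
  then show ?thesis
    unfolding divide_inverse by (intro bounded_lipschitz_bounded_bilinear[OF bounded_bilinear_mult] assms)
qed

text \<open>
  The explicit formula shows that the projection onto the ball is a positive multiple of \<open>v\<close>, while the
  Lipschitz property comes for free from the description as a closest point.
\<close>

lemma closest_point_unit_ball:
  fixes v :: "'a::euclidean_space"
  shows "closest_point (cball 0 1) v = v /\<^sub>R max 1 (norm v)"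
proof (cases "norm v \<le> 1")
  case True
  then show ?thesis by (simp add: closest_point_self max_absorb1)
next
  case False
  then have m: "max 1 (norm v) = norm v" "norm v > 0" by auto
  have "dist v (v /\<^sub>R norm v) = norm v - 1"
  proof -
    have "v - v /\<^sub>R norm v = (1 - inverse (norm v)) *\<^sub>R v"
      by (simp add: algebra_simps)
    then have "dist v (v /\<^sub>R norm v) = \<bar>1 - inverse (norm v)\<bar> * norm v"
      by (simp add: dist_norm)
    also have "\<bar>1 - inverse (norm v)\<bar> = 1 - inverse (norm v)"
      using False inverse_le_1_iff[of "norm v"] by simp
    finally show ?thesis using m(2) by (simp add: left_diff_distrib)
  qed
  moreover have "norm v - 1 \<le> dist v z" if "z \<in> cball 0 1" for z
    using that norm_triangle_ineq2[of v z] by (simp add: dist_norm)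
  ultimately have "v /\<^sub>R norm v = closest_point (cball 0 1) v"
    by (intro closest_point_unique) (use m in auto)
  then show ?thesis using m by simp
qed

lemma bounded_lipschitz_closest_point:
  assumes "convex S" "closed S" "bounded S" "S \<noteq> {}"
  shows "bounded_lipschitz (\<lambda>x :: 'a::euclidean_space ^ 'i::finite. closest_point S (x $ i))"
proof -
  obtain B where B: "\<And>v. v \<in> S \<Longrightarrow> norm v \<le> B"
    using \<open>bounded S\<close> by (auto simp: bounded_iff)
  show ?thesis
  proof (rule bounded_lipschitzI)
    show "norm (closest_point S (x $ i)) \<le> B" for x :: "'a ^ 'i"
      by (intro B closest_point_in_set assms)
    show "norm (closest_point S (x $ i) - closest_point S (y $ i)) \<le> 1 * dist x y" for x y :: "'a ^ 'i"
      using order_trans[OF closest_point_lipschitz[OF assms(1,2,4)] dist_vec_nth_le]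
      by (simp add: dist_norm)
  qed
qed

section \<open>The attention matrix and its floor\<close>

lemma sum_squares_rotation2:
  "(\<Sum>a\<in>UNIV. (\<Sum>b\<in>UNIV. rotation2 \<theta> $ a $ b * v b)\<^sup>2) = (\<Sum>a\<in>UNIV. (v a)\<^sup>2)"
proof -
  have "(cos \<theta> * v 1 - sin \<theta> * v 2)\<^sup>2 + (sin \<theta> * v 1 + cos \<theta> * v 2)\<^sup>2
      = ((sin \<theta>)\<^sup>2 + (cos \<theta>)\<^sup>2) * ((v 1)\<^sup>2 + (v 2)\<^sup>2)"
    by algebra
  then show ?thesis
    by (simp add: UNIV_2 rotation2_def)
qed

text \<open>
  The squared norm splits over the planes \<open>l\<close>, and in each plane the map is a plane rotation.
\<close>

lemma norm_block_rotation:
  fixes v :: "real ^ ('r::finite \<times> 2)"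
  shows "norm (block_rotation \<omega> p *v v) = norm v"
proof -
  have UNIV_eq: "(UNIV :: ('r \<times> 2) set) = UNIV \<times> UNIV" by simp
  have comp: "(block_rotation \<omega> p *v v) $ (l, a)
      = (\<Sum>b\<in>UNIV. rotation2 (\<omega> l * p) $ a $ b * v $ (l, b))" for l a
  proof -
    have "(block_rotation \<omega> p *v v) $ (l, a)
        = (\<Sum>k\<in>UNIV. \<Sum>b\<in>UNIV. if l = k then rotation2 (\<omega> l * p) $ a $ b * v $ (k, b) else 0)"
      by (simp add: matrix_vector_mult_def block_rotation_def UNIV_eq sum.cartesian_product'
          if_distribR if_distrib cong: if_cong del: UNIV_Times_UNIV)
    also have "\<dots> = (\<Sum>k\<in>UNIV. if l = k then \<Sum>b\<in>UNIV. rotation2 (\<omega> l * p) $ a $ b * v $ (k, b) else 0)"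
      by (intro sum.cong) auto
    finally show ?thesis by simp
  qed
  have sq: "(norm w)\<^sup>2 = (\<Sum>l\<in>UNIV. \<Sum>a\<in>UNIV. (w $ (l, a))\<^sup>2)" for w :: "real ^ ('r \<times> 2)"
    unfolding power2_norm_eq_inner inner_vec_def UNIV_eq sum.cartesian_product'
    by (simp add: power2_eq_square)
  have "(norm (block_rotation \<omega> p *v v))\<^sup>2 = (norm v)\<^sup>2"
    unfolding sq comp sum_squares_rotation2 ..
  then show ?thesis by simp
qed

lemma abs_score_le_1:
  assumes "x \<in> states"
  shows "\<bar>score p \<omega> x i j\<bar> \<le> 1"
proof -
  have "\<bar>score p \<omega> x i j\<bar> \<le> norm (x $ i) * norm (x $ j)"
    using Cauchy_Schwarz_ineq2[of "block_rotation \<omega> (p i) *v (x $ i)" "block_rotation \<omega> (p j) *v (x $ j)"]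
    by (simp add: score_def norm_block_rotation)
  with assms show ?thesis by (simp add: states_def)
qed

lemma kernel_pos: "0 < kernel \<beta> p \<omega> x $ i $ j"
  by (simp add: kernel_def)

lemma kernel_commute: "kernel \<beta> p \<omega> x $ i $ j = kernel \<beta> p \<omega> x $ j $ i"
  by (simp add: kernel_def score_def inner_commute)

lemma degree_pos: "0 < degree \<beta> p \<omega> x i"
  by (auto simp: degree_def intro!: sum_pos kernel_pos)

lemma attention_row_sum: "(\<Sum>j\<in>UNIV. attention \<beta> p \<omega> x $ i $ j) = 1"
  using degree_pos[of \<beta> p \<omega> x i]
  by (simp add: attention_def degree_def flip: sum_divide_distrib)

lemma detailed_balance:
  "stationary \<beta> p \<omega> x i * attention \<beta> p \<omega> x $ i $ j
    = stationary \<beta> p \<omega> x j * attention \<beta> p \<omega> x $ j $ i"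
  using degree_pos[of \<beta> p \<omega> x i] degree_pos[of \<beta> p \<omega> x j] kernel_commute[of \<beta> p \<omega> x i j]
  by (simp add: stationary_def attention_def)

text \<open>
  Multiplying numerator and denominator by \<open>exp (-\<beta>)\<close> displays the floor as the weight in a row with
  one score \<open>-1\<close> and all other scores \<open>1\<close>.
\<close>

lemma attention_floor_eq:
  "attention_floor \<beta> m = exp (- \<beta>) / (exp (- \<beta>) + (real m - 1) * exp \<beta>)"
proof -
  have "exp (- \<beta>) + (real m - 1) * exp \<beta> = exp (- \<beta>) * (1 + (real m - 1) * exp (2 * \<beta>))"
    by (simp add: distrib_left mult.left_commute flip: exp_add)
  then show ?thesis by (simp add: attention_floor_def)
qed

text \<open>
  For \<open>w \<ge> exp (-\<beta>)\<close> and \<open>S \<le> (n - 1) exp \<beta>\<close>, the fraction \<open>w / (w + S)\<close> is minimal at the end points;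
  cross-multiplied this is \<open>exp (-\<beta>) S \<le> w (n - 1) exp \<beta>\<close>.
\<close>

lemma attention_ge_floor:
  fixes x :: "('r::finite, 'n::finite) state"
  assumes "x \<in> states" and "0 \<le> \<beta>"
  shows "attention_floor \<beta> CARD('n) \<le> attention \<beta> p \<omega> x $ i $ j"
proof -
  let ?w = "\<lambda>k. kernel \<beta> p \<omega> x $ i $ k"
  let ?S = "\<Sum>k\<in>UNIV - {j}. ?w k"
  have n1: "0 \<le> real CARD('n) - 1"
    using zero_less_card_finite[where 'a='n] by linarith
  have deg: "degree \<beta> p \<omega> x i = ?w j + ?S"
    by (simp add: degree_def sum.remove[of UNIV j])
  have upper: "?w k \<le> exp \<beta>" and lower: "exp (- \<beta>) \<le> ?w k" for k
    using abs_score_le_1[OF assms(1), of p \<omega> i k] \<open>0 \<le> \<beta>\<close>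
      mult_left_mono[of "score p \<omega> x i k" 1 \<beta>] mult_left_mono[of "-1" "score p \<omega> x i k" \<beta>]
    by (auto simp: kernel_def abs_le_iff)
  have "?S \<le> real (card (UNIV - {j})) * exp \<beta>"
    by (intro sum_bounded_above upper)
  then have S: "?S \<le> (real CARD('n) - 1) * exp \<beta>" by (simp add: of_nat_diff Suc_leI)
  have "0 \<le> ?S" by (intro sum_nonneg less_imp_le kernel_pos)
  have "exp (- \<beta>) * ?S \<le> ?w j * ((real CARD('n) - 1) * exp \<beta>)"
    using lower S \<open>0 \<le> ?S\<close> by (intro mult_mono) (auto intro: less_imp_le kernel_pos)
  moreover have "0 < exp (- \<beta>) + (real CARD('n) - 1) * exp \<beta>"
    using n1 by (intro add_pos_nonneg) auto
  moreover have "0 < ?w j + ?S"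
    using kernel_pos[of \<beta> p \<omega> x i j] \<open>0 \<le> ?S\<close> by linarith
  ultimately have "exp (- \<beta>) / (exp (- \<beta>) + (real CARD('n) - 1) * exp \<beta>) \<le> ?w j / (?w j + ?S)"
    by (simp add: frac_le_eq divide_le_0_iff) (simp add: algebra_simps)
  then show ?thesis
    by (simp add: attention_floor_eq attention_def deg)
qed

text \<open>
  Zero positions and frequencies make every rotation trivial. Token \<open>j\<close> sits at \<open>- e\<close> and all others at
  \<open>e\<close>, so a row \<open>i \<noteq> j\<close> has one score \<open>-1\<close> and \<open>n - 1\<close> scores \<open>1\<close>, its own among them.
\<close>

lemma attention_floor_attained:
  assumes "CARD('n) \<ge> 2"
  shows "\<exists>(x :: ('r::finite, 'n::finite) state) i j. x \<in> states \<and>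
    attention \<beta> (\<lambda>_. 0) (\<lambda>_. 0) x $ i $ j = attention_floor \<beta> CARD('n)"
proof -
  obtain i j :: 'n where "i \<noteq> j"
    using assms by (metis card_2_iff' card_le_Suc0_iff_eq finite_class.finite_UNIV UNIV_I
        not_less_eq_eq numeral_2_eq_2)
  obtain e :: "real ^ ('r \<times> 2)" where "norm e = 1"
    using vector_choose_size[of 1] by auto
  define x :: "('r, 'n) state" where "x = (\<chi> k. if k = j then - e else e)"
  have x_nth: "x $ k = (if k = j then - e else e)" for k
    by (simp add: x_def)
  have "x \<in> states"
    using \<open>norm e = 1\<close> by (simp add: states_def x_nth)
  have "rotation2 0 = mat 1"
    by (simp add: rotation2_def mat_def vec_eq_iff forall_2)
  then have "block_rotation (\<lambda>_ :: 'r. 0) 0 = mat 1"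
    by (simp add: block_rotation_def mat_def vec_eq_iff prod_eq_iff)
  then have id: "block_rotation (\<lambda>_. 0) 0 *v v = v" for v :: "real ^ ('r \<times> 2)"
    by simp
  have w: "kernel \<beta> (\<lambda>_. 0) (\<lambda>_. 0) x $ i $ k = (if k = j then exp (- \<beta>) else exp \<beta>)" for k
    using \<open>i \<noteq> j\<close> \<open>norm e = 1\<close> by (simp add: kernel_def score_def x_nth id dot_square_norm)
  have "degree \<beta> (\<lambda>_. 0) (\<lambda>_. 0) x i = exp (- \<beta>) + (real CARD('n) - 1) * exp \<beta>"
    by (simp add: degree_def w sum.remove[of UNIV j] of_nat_diff Suc_leI)
  then have "attention \<beta> (\<lambda>_. 0) (\<lambda>_. 0) x $ i $ j = attention_floor \<beta> CARD('n)"
    by (simp add: attention_def w attention_floor_eq)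
  with \<open>x \<in> states\<close> show ?thesis by blast
qed

section \<open>The flow on the states\<close>

definition clip :: "('r::finite, 'n::finite) state \<Rightarrow> ('r, 'n) state" where
  "clip x = (\<chi> i. closest_point (cball 0 1) (x $ i))"

text \<open>
  The extension of the velocity to the whole space. The factor \<open>clip x $ i \<bullet> clip x $ i\<close>, which is \<open>1\<close> on the
  states, keeps the field orthogonal to \<open>x $ i\<close> everywhere.
\<close>

definition tangent_field ::
    "real \<Rightarrow> ('n::finite \<Rightarrow> real) \<Rightarrow> ('r::finite \<Rightarrow> real) \<Rightarrow> ('r, 'n) state \<Rightarrow> ('r, 'n) state" where
  "tangent_field \<beta> p \<omega> x = (\<chi> i. \<Sum>j\<in>UNIV. attention \<beta> p \<omega> (clip x) $ i $ j *\<^sub>R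
     ((clip x $ i \<bullet> clip x $ i) *\<^sub>R clip x $ j - (clip x $ i \<bullet> clip x $ j) *\<^sub>R clip x $ i))"

lemma clip_nth: "clip x $ i = (x $ i) /\<^sub>R max 1 (norm (x $ i))"
  by (simp add: clip_def closest_point_unit_ball)

text \<open>
  The field is orthogonal to the clipped token by construction, and the token itself is a multiple of it.
\<close>

lemma tangent_field_orthogonal: "x $ i \<bullet> tangent_field \<beta> p \<omega> x $ i = 0"
proof -
  have "x $ i = max 1 (norm (x $ i)) *\<^sub>R clip x $ i"
    by (simp add: clip_nth)
  moreover have "clip x $ i \<bullet> tangent_field \<beta> p \<omega> x $ i = 0"
    by (simp add: tangent_field_def inner_sum_right inner_diff_right)
  ultimately show ?thesis by (metis inner_scaleR_left mult_zero_right)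
qed

lemma tangent_field_eq_velocity:
  assumes "x \<in> states"
  shows "tangent_field \<beta> p \<omega> x $ i = velocity \<beta> p \<omega> x i"
proof -
  have "clip x = x"
    using assms by (simp add: vec_eq_iff clip_nth states_def)
  then show ?thesis
    using assms by (simp add: tangent_field_def velocity_def states_def dot_square_norm)
qed

text \<open>
  All quantities are polynomials, exponentials and quotients in the bounded Lipschitz map \<open>clip\<close>. The
  degrees stay away from \<open>0\<close>: a bound \<open>B\<close> for the absolute exponents on the diagonal keeps the
  diagonal entry of each kernel row, hence its degree, above \<open>exp (- B)\<close>.
\<close>

lemma bounded_lipschitz_tangent_field:
  "bounded_lipschitz (tangent_field \<beta> p \<omega>)"
proof -
  have clip: "bounded_lipschitz (\<lambda>x. clip x $ i)" for i
    unfolding clip_def by (simp add: bounded_lipschitz_closest_point)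
  note bl = bounded_lipschitz_const
    bounded_lipschitz_bounded_bilinear[OF bounded_bilinear_inner]
    bounded_lipschitz_bounded_bilinear[OF bounded_bilinear_scaleR]
    bounded_lipschitz_bounded_bilinear[OF bounded_bilinear_mult]
  have score: "bounded_lipschitz (\<lambda>x. \<beta> * score p \<omega> (clip x) i j)" for i j
    unfolding score_def
    by (intro bl clip bounded_lipschitz_bounded_linear[OF matrix_vector_mul_bounded_linear])
  then have kernel: "bounded_lipschitz (\<lambda>x. kernel \<beta> p \<omega> (clip x) $ i $ j)" for i j
    by (simp add: kernel_def bounded_lipschitz_exp)
  then have degree: "bounded_lipschitz (\<lambda>x. degree \<beta> p \<omega> (clip x) i)" for i
    unfolding degree_def by (intro bounded_lipschitz_sum)
  have "bounded_lipschitz (\<lambda>x. attention \<beta> p \<omega> (clip x) $ i $ j)" for i j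
  proof -
    obtain B where B: "\<And>x. \<bar>\<beta> * score p \<omega> (clip x) i i\<bar> \<le> B"
      using score[of i i] by (auto simp: bounded_lipschitz_def)
    have "exp (- B) \<le> degree \<beta> p \<omega> (clip x) i" for x
    proof -
      have "exp (- B) \<le> kernel \<beta> p \<omega> (clip x) $ i $ i"
        using B[of x] by (simp add: kernel_def abs_le_iff)
      also have "\<dots> \<le> degree \<beta> p \<omega> (clip x) i"
        unfolding degree_def by (intro member_le_sum) (auto intro: less_imp_le kernel_pos)
      finally show ?thesis .
    qed
    then show ?thesis
      by (simp add: attention_def bounded_lipschitz_divide[OF kernel degree, of "exp (- B)"])
  qed
  then show ?thesis
    unfolding tangent_field_def
    by (intro bounded_lipschitz_vec bounded_lipschitz_sum bounded_lipschitz_diff bl clip)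
qed

lemma has_vector_derivative_vecI:
  fixes X :: "real \<Rightarrow> 'a::euclidean_space ^ 'i::finite"
  assumes "\<And>i. ((\<lambda>s. X s $ i) has_vector_derivative D $ i) (at t within S)"
  shows "(X has_vector_derivative D) (at t within S)"
proof -
  have "((\<lambda>s. X s \<bullet> b) has_derivative (\<lambda>h. (h *\<^sub>R D) \<bullet> b)) (at t within S)"
    if "b \<in> Basis" for b :: "'a ^ 'i"
  proof -
    obtain i u where b: "b = axis i u"
      using \<open>b \<in> Basis\<close> unfolding Basis_vec_def by blast
    show ?thesis
      using has_derivative_inner_left[OF assms[of i, unfolded has_vector_derivative_def], of u]
      by (simp add: b inner_axis)
  qed
  then show ?thesis
    unfolding has_vector_derivative_def has_derivative_componentwise_within[of X] by blast
qed

text \<open>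
  A global solution remains in the states, where the two fields agree; so the flow can be studied with the
  Lipschitz field instead.
\<close>

lemma global_solution_iff_tangent_field:
  "global_solution \<beta> p \<omega> x0 X \<longleftrightarrow> X 0 = x0 \<and>
    (\<forall>t\<ge>0. X t \<in> states \<and>
      (X has_vector_derivative tangent_field \<beta> p \<omega> (X t)) (at t within {0..}))"
proof -
  have "(\<forall>i. ((\<lambda>s. X s $ i) has_vector_derivative velocity \<beta> p \<omega> (X t) i) (at t within {0..}))
      \<longleftrightarrow> (X has_vector_derivative tangent_field \<beta> p \<omega> (X t)) (at t within {0..})"
    if "X t \<in> states" for t
  proof
    assume "\<forall>i. ((\<lambda>s. X s $ i) has_vector_derivative velocity \<beta> p \<omega> (X t) i) (at t within {0..})"
    then have "((\<lambda>s. X s $ i) has_vector_derivative tangent_field \<beta> p \<omega> (X t) $ i) (at t within {0..})" for i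
      by (simp add: tangent_field_eq_velocity[OF that])
    then show "(X has_vector_derivative tangent_field \<beta> p \<omega> (X t)) (at t within {0..})"
      by (rule has_vector_derivative_vecI)
  next
    assume "(X has_vector_derivative tangent_field \<beta> p \<omega> (X t)) (at t within {0..})"
    then show "\<forall>i. ((\<lambda>s. X s $ i) has_vector_derivative velocity \<beta> p \<omega> (X t) i) (at t within {0..})"
      by (auto simp flip: tangent_field_eq_velocity[OF that]
          intro!: bounded_linear.has_vector_derivative[OF bounded_linear_vec_nth])
  qed
  then show ?thesis unfolding global_solution_def by blast
qed

text \<open>
  The derivative of \<open>|X\<^sub>i|\<^sup>2\<close> is \<open>2 X\<^sub>i \<bullet> F\<^sub>i(X) = 0\<close>, by orthogonality of the field.
\<close>

lemma tangent_field_solution_in_states: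
  assumes "X 0 \<in> states"
    and deriv: "\<And>t. 0 \<le> t \<Longrightarrow>
      (X has_vector_derivative tangent_field \<beta> p \<omega> (X t)) (at t within {0..})"
    and "0 \<le> t"
  shows "X t \<in> states"
proof -
  have "norm (X t $ i) = 1" for i
  proof -
    have "((\<lambda>s. X s $ i \<bullet> X s $ i) has_derivative (\<lambda>h. 0)) (at s within {0..})" if "s \<in> {0..}" for s
    proof -
      have "((\<lambda>s. X s $ i) has_derivative (\<lambda>h. h *\<^sub>R tangent_field \<beta> p \<omega> (X s) $ i)) (at s within {0..})"
        using bounded_linear.has_vector_derivative[OF bounded_linear_vec_nth deriv, of s i] that
        by (simp add: has_vector_derivative_def)
      from has_derivative_inner[OF this this] show ?thesis
        by (simp add: tangent_field_orthogonal inner_commute[of "tangent_field \<beta> p \<omega> (X s) $ i"])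
    qed
    then have "X t $ i \<bullet> X t $ i = X 0 $ i \<bullet> X 0 $ i"
      using \<open>0 \<le> t\<close> by (intro has_derivative_zero_unique[of "{0..}"]) auto
    moreover have "X 0 $ i \<bullet> X 0 $ i = 1"
      using assms(1) by (simp add: states_def dot_square_norm)
    ultimately show ?thesis by (simp add: norm_eq_1)
  qed
  then show ?thesis by (simp add: states_def)
qed

theorem global_solution_unique_exists:
  assumes "x0 \<in> states"
  shows "\<exists>X. global_solution \<beta> p \<omega> x0 X \<and>
    (\<forall>Y. global_solution \<beta> p \<omega> x0 Y \<longrightarrow> (\<forall>t\<ge>0. Y t = X t))"
proof -
  obtain L where lip: "L-lipschitz_on UNIV (tangent_field \<beta> p \<omega>)"
    using bounded_lipschitz_tangent_field[of \<beta> p \<omega>] unfolding bounded_lipschitz_def by blast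
  obtain X where X: "X 0 = x0"
    "\<And>t. 0 \<le> t \<Longrightarrow> (X has_vector_derivative tangent_field \<beta> p \<omega> (X t)) (at t within {0..})"
    using lipschitz_global_solution_exists[OF lip, of x0] by blast
  have "X t \<in> states" if "0 \<le> t" for t
    by (rule tangent_field_solution_in_states[OF _ X(2) that]) (simp_all add: X(1) assms)
  with X have "global_solution \<beta> p \<omega> x0 X"
    by (simp add: global_solution_iff_tangent_field)
  moreover have "Y t = X t" if Y: "global_solution \<beta> p \<omega> x0 Y" and "0 \<le> t" for Y t
  proof (rule lipschitz_solution_unique[OF lip UNIV_I _ UNIV_I X(2)])
    show "(Y has_vector_derivative tangent_field \<beta> p \<omega> (Y s)) (at s within {0..})" if "0 \<le> s" for s
      using Y that by (simp add: global_solution_iff_tangent_field)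
    show "Y 0 = X 0"
      using Y X(1) by (simp add: global_solution_iff_tangent_field)
  qed (use \<open>0 \<le> t\<close> in auto)
  ultimately show ?thesis by blast
qed

theorem theorem3p1:
  fixes \<beta> :: real
    and p :: "'n::finite \<Rightarrow> real"
    and \<omega> :: "'r::finite \<Rightarrow> real"
  assumes n: "CARD('n) \<ge> 2"
    and beta: "0 \<le> \<beta>"
  shows
    "(\<forall>x0 \<in> (states :: ('r, 'n) state set).
        \<exists>X. global_solution \<beta> p \<omega> x0 X \<and>
            (\<forall>Y. global_solution \<beta> p \<omega> x0 Y \<longrightarrow> (\<forall>t\<ge>0. Y t = X t))) \<and>
     (\<forall>x \<in> (states :: ('r, 'n) state set).
        kernel \<beta> p \<omega> x = transpose (kernel \<beta> p \<omega> x) \<and>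
        attention \<beta> p \<omega> x *v vec 1 = vec 1 \<and>
        (\<forall>i j. stationary \<beta> p \<omega> x i * attention \<beta> p \<omega> x $ i $ j
             = stationary \<beta> p \<omega> x j * attention \<beta> p \<omega> x $ j $ i) \<and>
        (\<forall>i j. attention \<beta> p \<omega> x $ i $ j \<ge> attention_floor \<beta> CARD('n))) \<and>
     attention_floor \<beta> CARD('n) = exp (- 2 * \<beta>) / (real CARD('n) - 1 + exp (- 2 * \<beta>)) \<and>
     (\<forall>c > attention_floor \<beta> CARD('n).
        \<not> (\<forall>(q :: 'n \<Rightarrow> real) (\<nu> :: 'r \<Rightarrow> real). \<forall>x \<in> states. \<forall>i j.
              c \<le> attention \<beta> q \<nu> x $ i $ j)) \<and>
     (\<beta> = 0 \<longrightarrow> attention_floor \<beta> CARD('n) = 1 / real CARD('n)) \<and>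
     (\<beta> > 0 \<longrightarrow> attention_floor \<beta> CARD('n) > exp (- 2 * \<beta>) / real CARD('n))"
proof -
  have solution: "\<forall>x0 \<in> (states :: ('r, 'n) state set).
      \<exists>X. global_solution \<beta> p \<omega> x0 X \<and>
          (\<forall>Y. global_solution \<beta> p \<omega> x0 Y \<longrightarrow> (\<forall>t\<ge>0. Y t = X t))"
    using global_solution_unique_exists by blast
  have pointwise: "kernel \<beta> p \<omega> x = transpose (kernel \<beta> p \<omega> x) \<and>
      attention \<beta> p \<omega> x *v vec 1 = vec 1 \<and>
      (\<forall>i j. stationary \<beta> p \<omega> x i * attention \<beta> p \<omega> x $ i $ j
           = stationary \<beta> p \<omega> x j * attention \<beta> p \<omega> x $ j $ i) \<and>
      (\<forall>i j. attention \<beta> p \<omega> x $ i $ j \<ge> attention_floor \<beta> CARD('n))"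
    if "x \<in> states" for x :: "('r, 'n) state"
  proof (intro conjI allI)
    show "kernel \<beta> p \<omega> x = transpose (kernel \<beta> p \<omega> x)"
      by (simp add: vec_eq_iff transpose_def kernel_commute)
    show "attention \<beta> p \<omega> x *v vec 1 = vec 1"
      by (simp add: vec_eq_iff matrix_vector_mult_def attention_row_sum)
  qed (use that beta in \<open>auto intro: attention_ge_floor detailed_balance\<close>)
  have floor: "attention_floor \<beta> CARD('n) = exp (- 2 * \<beta>) / (real CARD('n) - 1 + exp (- 2 * \<beta>))"
  proof -
    have "real CARD('n) - 1 + exp (- 2 * \<beta>)
        = exp (- 2 * \<beta>) * (1 + (real CARD('n) - 1) * exp (2 * \<beta>))"
      by (simp add: exp_minus field_simps)
    then show ?thesis by (simp add: attention_floor_def)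
  qed
  have sharp: "\<not> (\<forall>(q :: 'n \<Rightarrow> real) (\<nu> :: 'r \<Rightarrow> real). \<forall>x \<in> states. \<forall>i j.
      c \<le> attention \<beta> q \<nu> x $ i $ j)" if "c > attention_floor \<beta> CARD('n)" for c
    using attention_floor_attained[OF n, where 'r='r, of \<beta>] that by (metis not_le)
  have zero: "attention_floor \<beta> CARD('n) = 1 / real CARD('n)" if "\<beta> = 0"
    using that by (simp add: attention_floor_def)
  have strict: "attention_floor \<beta> CARD('n) > exp (- 2 * \<beta>) / real CARD('n)" if "\<beta> > 0"
    unfolding floor
  proof (rule divide_strict_left_mono)
    show "real CARD('n) - 1 + exp (- 2 * \<beta>) < real CARD('n)"
      using that by simp
    have "0 < real CARD('n) - 1 + exp (- 2 * \<beta>)"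
      using n by (intro add_pos_pos) auto
    then show "0 < real CARD('n) * (real CARD('n) - 1 + exp (- 2 * \<beta>))" by simp
  qed simp
  show ?thesis
    using solution pointwise floor sharp zero strict by blast
qed

end
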